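(* Let $\alpha$ be a real number and let $f_\alpha:(0,1]\to\mathbb{R}$ be the function $$f_\alpha(x)=\frac{\alpha+\sqrt{1+x}+\sqrt{1-x}}{\sqrt{1+x}-\sqrt{1-x}}\,\arcsin x,\qquad x\in(0,1].$$ Then: (1) if $\alpha\ge 4$, then $f_\alpha$ is strictly increasing on $(0,1]$; (2) if $\alpha\le\frac{4(\pi-2)}{\sqrt{2}\,(4-\pi)}$, then $f_\alpha$ is strictly decreasing on $(0,1]$; (3) if $4>\alpha>\frac{4(\pi-2)}{\sqrt{2}\,(4-\pi)}$, then $f_\alpha$ has a unique minimum on $(0,1]$.
   Context: Here $\arcsin$ is the principal inverse sine, so $\arcsin x\in(0,\pi/2]$ for $x\in(0,1]$. "Has a unique minimum" means that the minimum value of the function over its domain is attained, and at exactly one point. *)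

theory Defs
  imports Complex_Main
begin

text \<open>
  Only the values on \<open>{0<..1}\<close> matter: there the denominator is positive and both square roots
  have non-negative arguments.
\<close>

definition f_alpha :: "real \<Rightarrow> real \<Rightarrow> real" where
  "f_alpha \<alpha> x = (\<alpha> + sqrt (1 + x) + sqrt (1 - x)) / (sqrt (1 + x) - sqrt (1 - x)) * arcsin x"

end

theory Submission
  imports Defs "HOL-Real_Asymp.Real_Asymp"
begin

text \<open>
  Substituting \<open>x = sin (2 * s)\<close> turns \<open>f_alpha \<alpha> x\<close> into \<open>s * (\<alpha> + 2 * cos s) / sin s\<close> with
  \<open>0 < s \<le> pi / 4\<close>. Its derivative has the sign of \<open>\<alpha> - h s\<close>, where
  \<open>h s = (2 * s - sin (2 * s)) / (sin s - s * cos s)\<close> decreases strictly from the limit \<open>4\<close> at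
  \<open>0\<close> to \<open>h (pi / 4) = 4 * (pi - 2) / (sqrt 2 * (4 - pi))\<close>.
\<close>

definition half_angle_fun :: "real \<Rightarrow> real \<Rightarrow> real" where
  "half_angle_fun \<alpha> s = s * (\<alpha> + 2 * cos s) / sin s"

text \<open>This is \<open>h\<close> above: for \<open>0 < s < pi\<close>, the one value of \<alpha>
  that makes \<open>s\<close> a stationary point of \<open>half_angle_fun \<alpha>\<close>.\<close>

definition critical_alpha :: "real \<Rightarrow> real" where
  "critical_alpha s = (2 * s - sin (2 * s)) / (sin s - s * cos s)"

section \<open>Monotonicity and range of the critical parameter\<close>

text \<open>The difference vanishes at 0 and has derivative \<open>x * sin x\<close>. It is the
  denominator of \<open>critical_alpha\<close>.\<close>

lemma mult_cos_less_sin: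
  fixes s :: real
  assumes "0 < s" "s \<le> pi"
  shows "s * cos s < sin s"
proof -
  have "sin 0 - 0 * cos 0 < sin s - s * cos s"
  proof (rule DERIV_pos_imp_increasing_open[OF assms(1)])
    fix x assume x: "0 < x" "x < s"
    have "((\<lambda>x. sin x - x * cos x) has_real_derivative x * sin x) (at x)"
      by (auto intro!: derivative_eq_intros)
    moreover have "0 < x * sin x"
      using x assms by (simp add: sin_gt_zero)
    ultimately show "\<exists>y. ((\<lambda>x. sin x - x * cos x) has_real_derivative y) (at x) \<and> 0 < y"
      by blast
  qed (intro continuous_intros)
  then show ?thesis by simp
qed

text \<open>The difference \<open>k\<close> of the two sides and its derivative \<open>k'\<close>
  both vanish at 0, and the second derivative is negative on the open interval by
  \<open>mult_cos_less_sin\<close>; integrating the sign twice gives the claim. It decides the sign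
  of the derivative of \<open>critical_alpha\<close>.\<close>

lemma two_sin_squared_less:
  fixes s :: real
  assumes "0 < s" "s \<le> pi"
  shows "2 * (sin s)\<^sup>2 < s * sin s * cos s + s\<^sup>2"
proof -
  define k where "k = (\<lambda>x::real. 2 * (sin x)\<^sup>2 - x * sin x * cos x - x\<^sup>2)"
  define k' where "k' = (\<lambda>x::real. 3 * sin x * cos x - x * ((cos x)\<^sup>2 - (sin x)\<^sup>2) - 2 * x)"
  have deriv_k: "(k has_real_derivative k' x) (at x)" for x
    unfolding k_def k'_def
    by (auto intro!: derivative_eq_intros simp: algebra_simps power2_eq_square)
  have deriv_k': "(k' has_real_derivative - (4 * sin x * (sin x - x * cos x))) (at x)" for x
  proof -
    have "(k' has_real_derivative 2 * (cos x)\<^sup>2 - 2 * (sin x)\<^sup>2 + 4 * x * sin x * cos x - 2) (at x)"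
      unfolding k'_def
      by (auto intro!: derivative_eq_intros simp: algebra_simps power2_eq_square)
    moreover have "2 * (cos x)\<^sup>2 - 2 * (sin x)\<^sup>2 + 4 * x * sin x * cos x - 2
        = - (4 * sin x * (sin x - x * cos x))"
      unfolding cos_squared_eq by (simp add: algebra_simps power2_eq_square)
    ultimately show ?thesis by simp
  qed
  have cont: "continuous_on A k" "continuous_on A k'" for A
    unfolding k_def k'_def by (intro continuous_intros)+
  have k'_neg: "k' x < 0" if x: "0 < x" "x \<le> pi" for x
  proof -
    have "k' x < k' 0"
    proof (rule DERIV_neg_imp_decreasing_open[OF x(1) _ cont(2)])
      fix y assume y: "0 < y" "y < x"
      have "- (4 * sin y * (sin y - y * cos y)) < 0"
        using mult_cos_less_sin[of y] sin_gt_zero[of y] x y by simp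
      with deriv_k' show "\<exists>z. (k' has_real_derivative z) (at y) \<and> z < 0" by blast
    qed
    then show ?thesis by (simp add: k'_def)
  qed
  have "k s < k 0"
  proof (rule DERIV_neg_imp_decreasing_open[OF assms(1) _ cont(1)])
    fix x assume "0 < x" "x < s"
    then have "k' x < 0" using k'_neg assms by simp
    with deriv_k show "\<exists>z. (k has_real_derivative z) (at x) \<and> z < 0" by blast
  qed
  then show ?thesis by (simp add: k_def)
qed

lemma DERIV_critical_alpha_neg:
  fixes s :: real
  assumes "0 < s" "s < pi"
  shows "\<exists>y. (critical_alpha has_real_derivative y) (at s) \<and> y < 0"
proof -
  define q where "q = sin s - s * cos s"
  have q: "q > 0"
    using mult_cos_less_sin[of s] assms by (simp add: q_def)
  define y where "y = ((2 - cos (2 * s) * 2) * q - (2 * s - sin (2 * s)) * (s * sin s)) / (q * q)"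
  have "(critical_alpha has_real_derivative y) (at s)"
    unfolding critical_alpha_def y_def q_def using q
    by (auto intro!: derivative_eq_intros simp: q_def)
  \<comment> \<open>The numerator from the quotient rule factors, leaving exactly the expression of
    \<open>two_sin_squared_less\<close>.\<close>
  moreover have "(2 - cos (2 * s) * 2) * q - (2 * s - sin (2 * s)) * (s * sin s)
      = 2 * sin s * (2 * (sin s)\<^sup>2 - s * sin s * cos s - s\<^sup>2)"
    unfolding q_def cos_double_sin sin_double by (simp add: algebra_simps power2_eq_square)
  moreover have "2 * sin s * (2 * (sin s)\<^sup>2 - s * sin s * cos s - s\<^sup>2) < 0"
    using two_sin_squared_less[of s] sin_gt_zero[of s] assms
    by (intro mult_pos_neg) auto
  ultimately show ?thesis
    using q by (auto simp: y_def intro!: divide_neg_pos exI[of _ y])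
qed

lemma continuous_on_critical_alpha: "continuous_on {0<..<pi} critical_alpha"
  using DERIV_critical_alpha_neg DERIV_isCont
  by (fastforce intro!: continuous_at_imp_continuous_on)

lemma critical_alpha_less:
  assumes "0 < s" "s < t" "t < pi"
  shows "critical_alpha t < critical_alpha s"
  using assms by (intro DERIV_neg_imp_decreasing[OF assms(2)] DERIV_critical_alpha_neg) auto

text \<open>Numerator and denominator both vanish to third order, with leading terms 4/3 s^3 and 1/3
  s^3.\<close>

lemma critical_alpha_tendsto: "(critical_alpha \<longlongrightarrow> 4) (at_right 0)"
  unfolding critical_alpha_def by real_asymp

lemma critical_alpha_less_4:
  assumes "0 < s" "s < pi"
  shows "critical_alpha s < 4"
proof -
  \<comment> \<open>The limit only yields a weak bound; taking it at \<open>s / 2\<close> lets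
    strict decrease from \<open>s / 2\<close> to \<open>s\<close> make it strict.\<close>
  have "critical_alpha (s / 2) \<le> 4"
  proof (rule tendsto_lowerbound[OF critical_alpha_tendsto])
    have "eventually (\<lambda>t. t \<in> {0<..<s / 2}) (at_right 0)"
      using assms by (intro eventually_at_right_real) auto
    then show "\<forall>\<^sub>F t in at_right 0. critical_alpha (s / 2) \<le> critical_alpha t"
      by eventually_elim (use assms in \<open>auto intro!: less_imp_le critical_alpha_less\<close>)
  qed simp
  with critical_alpha_less[of "s / 2" s] assms show ?thesis by simp
qed

lemma critical_alpha_pi_fourth: "critical_alpha (pi / 4) = 4 * (pi - 2) / (sqrt 2 * (4 - pi))"
proof -
  have "critical_alpha (pi / 4) = (pi / 2 - 1) / (sqrt 2 / 2 - pi / 4 * (sqrt 2 / 2))"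
    by (simp add: critical_alpha_def sin_45 cos_45)
  also have "sqrt 2 / 2 - pi / 4 * (sqrt 2 / 2) = sqrt 2 * (4 - pi) / 8"
    by (simp add: field_simps)
  also have "pi / 2 - 1 = 4 * (pi - 2) / 8"
    by simp
  also have "4 * (pi - 2) / 8 / (sqrt 2 * (4 - pi) / 8) = 4 * (pi - 2) / (sqrt 2 * (4 - pi))"
    by (simp only: divide_divide_eq_left divide_divide_eq_right)
  finally show ?thesis .
qed

section \<open>Monotonicity of the half-angle function\<close>

text \<open>The derivative is factored so that its second factor is positive and the sign rests with
  \<alpha> and \<open>critical_alpha s\<close>.\<close>

lemma DERIV_half_angle_fun:
  assumes "0 < s" "s < pi"
  shows "(half_angle_fun \<alpha> has_real_derivative
    (\<alpha> - critical_alpha s) * ((sin s - s * cos s) / (sin s)\<^sup>2)) (at s)"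
proof -
  have nz: "sin s - s * cos s \<noteq> 0" "sin s \<noteq> 0"
    using mult_cos_less_sin[of s] sin_gt_zero[of s] assms by auto
  have "(half_angle_fun \<alpha> has_real_derivative
      ((\<alpha> + 2 * cos s - 2 * s * sin s) * sin s - s * (\<alpha> + 2 * cos s) * cos s) / (sin s)\<^sup>2) (at s)"
    unfolding half_angle_fun_def using nz
    by (auto intro!: derivative_eq_intros simp: algebra_simps power2_eq_square)
  \<comment> \<open>Keeping the sum of squares unreduced makes this a polynomial identity in
    \<open>sin s\<close> and \<open>cos s\<close>.\<close>
  moreover have "(\<alpha> + 2 * cos s - 2 * s * sin s) * sin s - s * (\<alpha> + 2 * cos s) * cos s
      = \<alpha> * (sin s - s * cos s) - (2 * s * ((sin s)\<^sup>2 + (cos s)\<^sup>2) - 2 * sin s * cos s)"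
    by (simp only: power2_eq_square algebra_simps)
  moreover have "critical_alpha s * (sin s - s * cos s) = 2 * s - 2 * sin s * cos s"
    using nz(1) by (simp add: critical_alpha_def sin_double)
  ultimately show ?thesis by (simp add: left_diff_distrib)
qed

text \<open>As \<open>critical_alpha\<close> decreases, the condition at the left end becomes strict
  inside the interval. Equality at \<open>s\<close> is allowed so that \<open>s\<close> may itself
  be the stationary point. In the mirror lemma below the condition sits at the right end.\<close>

lemma half_angle_fun_less:
  assumes "0 < s" "s < t" "t < pi" "critical_alpha s \<le> \<alpha>"
  shows "half_angle_fun \<alpha> s < half_angle_fun \<alpha> t"
proof (rule DERIV_pos_imp_increasing_open[OF assms(2)])
  fix x assume x: "s < x" "x < t"
  have "critical_alpha x < \<alpha>"
    using critical_alpha_less[of s x] x assms by simp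
  moreover have "0 < sin x" "0 < sin x - x * cos x"
    using mult_cos_less_sin[of x] sin_gt_zero[of x] x assms by auto
  ultimately have "0 < (\<alpha> - critical_alpha x) * ((sin x - x * cos x) / (sin x)\<^sup>2)"
    by (intro mult_pos_pos divide_pos_pos) auto
  then show "\<exists>y. (half_angle_fun \<alpha> has_real_derivative y) (at x) \<and> 0 < y"
    using DERIV_half_angle_fun[of x] x assms by (metis less_trans)
qed (use assms in \<open>auto intro!: continuous_at_imp_continuous_on DERIV_isCont DERIV_half_angle_fun\<close>)

lemma half_angle_fun_greater:
  assumes "0 < s" "s < t" "t < pi" "\<alpha> \<le> critical_alpha t"
  shows "half_angle_fun \<alpha> t < half_angle_fun \<alpha> s"
proof (rule DERIV_neg_imp_decreasing_open[OF assms(2)])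
  fix x assume x: "s < x" "x < t"
  have "\<alpha> < critical_alpha x"
    using critical_alpha_less[of x t] x assms by simp
  moreover have "0 < sin x" "0 < sin x - x * cos x"
    using mult_cos_less_sin[of x] sin_gt_zero[of x] x assms by auto
  ultimately have "(\<alpha> - critical_alpha x) * ((sin x - x * cos x) / (sin x)\<^sup>2) < 0"
    by (intro mult_neg_pos divide_pos_pos) auto
  then show "\<exists>y. (half_angle_fun \<alpha> has_real_derivative y) (at x) \<and> y < 0"
    using DERIV_half_angle_fun[of x] x assms by (metis less_trans)
qed (use assms in \<open>auto intro!: continuous_at_imp_continuous_on DERIV_isCont DERIV_half_angle_fun\<close>)

section \<open>Transfer between the original and the half-angle variable\<close>

text \<open>Both radicands are perfect squares, of \<open>cos s + sin s\<close> and
  \<open>cos s - sin s\<close>; the bound \<open>s \<le> pi / 4\<close> makes the latter root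
  nonnegative and keeps \<open>2 * s\<close> in the range of \<open>arcsin\<close>.\<close>

lemma f_alpha_sin_double:
  assumes "0 < s" "s \<le> pi / 4"
  shows "f_alpha \<alpha> (sin (2 * s)) = half_angle_fun \<alpha> s"
proof -
  have "sin s \<le> sin (pi / 4)" "cos (pi / 4) \<le> cos s"
    using assms by (auto intro!: sin_monotone_2pi_le cos_monotone_0_pi_le)
  then have le: "sin s \<le> cos s" by (simp add: sin_45 cos_45)
  have pos: "0 < sin s" using assms by (intro sin_gt_zero) auto
  have "1 + sin (2 * s) = (cos s + sin s)\<^sup>2" "1 - sin (2 * s) = (cos s - sin s)\<^sup>2"
    unfolding sin_double power2_sum power2_diff by (simp_all add: cos_squared_eq)
  then have "sqrt (1 + sin (2 * s)) = cos s + sin s" "sqrt (1 - sin (2 * s)) = cos s - sin s"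
    using le pos by (simp_all add: real_sqrt_unique)
  moreover have "arcsin (sin (2 * s)) = 2 * s"
    using assms by (intro arcsin_sin) auto
  ultimately have "f_alpha \<alpha> (sin (2 * s))
      = (\<alpha> + (cos s + sin s) + (cos s - sin s)) / ((cos s + sin s) - (cos s - sin s)) * (2 * s)"
    by (simp only: f_alpha_def)
  then show ?thesis
    using pos by (simp add: half_angle_fun_def field_simps)
qed

lemma f_alpha_eq_half_angle_fun:
  assumes "x \<in> {0<..1}"
  shows "f_alpha \<alpha> x = half_angle_fun \<alpha> (arcsin x / 2)"
    and "0 < arcsin x / 2" and "arcsin x / 2 \<le> pi / 4"
proof -
  have "0 < arcsin x"
    using assms arcsin_less_mono[of 0 x] by simp
  moreover have "arcsin x \<le> pi / 2"
    using assms arcsin_ubound[of x] by simp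
  ultimately show bounds: "0 < arcsin x / 2" "arcsin x / 2 \<le> pi / 4" by auto
  have "sin (2 * (arcsin x / 2)) = x"
    using assms by simp
  with f_alpha_sin_double[OF bounds] show "f_alpha \<alpha> x = half_angle_fun \<alpha> (arcsin x / 2)"
    by metis
qed

text \<open>The minimiser is the solution of \<open>critical_alpha c = \<alpha>\<close>: the
  function falls before it and rises after it.\<close>

lemma half_angle_fun_unique_min:
  assumes "critical_alpha (pi / 4) < \<alpha>" "\<alpha> < 4"
  obtains c where "0 < c" "c \<le> pi / 4"
    "\<And>s. 0 < s \<Longrightarrow> s \<le> pi / 4 \<Longrightarrow> s \<noteq> c \<Longrightarrow> half_angle_fun \<alpha> c < half_angle_fun \<alpha> s"
proof -
  \<comment> \<open>At 0 itself \<open>critical_alpha\<close> is 0/0, that is 0, so the limit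
    supplies a positive left end \<open>a\<close> for the intermediate value theorem.\<close>
  have "eventually (\<lambda>t. \<alpha> < critical_alpha t \<and> t \<in> {0<..<pi / 4}) (at_right 0)"
    using order_tendstoD(1)[OF critical_alpha_tendsto assms(2)]
    by (rule eventually_conj) (intro eventually_at_right_real, simp)
  then obtain a where a: "\<alpha> < critical_alpha a" "0 < a" "a < pi / 4"
    using eventually_happens by force
  have "continuous_on {a..pi / 4} critical_alpha"
    using a by (intro continuous_on_subset[OF continuous_on_critical_alpha]) auto
  then obtain c where c: "a \<le> c" "c \<le> pi / 4" "critical_alpha c = \<alpha>"
    using IVT2'[of critical_alpha "pi / 4" \<alpha> a] a assms by auto
  show thesis
  proof (rule that)
    fix s assume s: "0 < s" "s \<le> pi / 4" "s \<noteq> c"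
    show "half_angle_fun \<alpha> c < half_angle_fun \<alpha> s"
    proof (cases "s < c")
      case True
      with s a c show ?thesis by (intro half_angle_fun_greater) auto
    next
      case False
      with s a c show ?thesis by (intro half_angle_fun_less) auto
    qed
  qed (use a c in auto)
qed

theorem theorem1:
  fixes \<alpha> :: real
  shows "(\<alpha> \<ge> 4 \<longrightarrow> strict_mono_on {0<..1} (f_alpha \<alpha>)) \<and>
    (\<alpha> \<le> 4 * (pi - 2) / (sqrt 2 * (4 - pi)) \<longrightarrow> strict_antimono_on {0<..1} (f_alpha \<alpha>)) \<and>
    (4 > \<alpha> \<and> \<alpha> > 4 * (pi - 2) / (sqrt 2 * (4 - pi)) \<longrightarrow>
      (\<exists>!x\<in>{0<..1}. \<forall>y\<in>{0<..1}. f_alpha \<alpha> x \<le> f_alpha \<alpha> y))"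
proof (intro conjI impI)
  assume \<alpha>: "\<alpha> \<ge> 4"
  show "strict_mono_on {0<..1} (f_alpha \<alpha>)"
  proof (rule strict_mono_onI)
    fix x y :: real assume xy: "x \<in> {0<..1}" "y \<in> {0<..1}" "x < y"
    then have "arcsin x / 2 < arcsin y / 2"
      by (simp add: arcsin_less_mono)
    moreover have "critical_alpha (arcsin x / 2) < 4"
      using f_alpha_eq_half_angle_fun(2,3)[OF xy(1)] by (intro critical_alpha_less_4) auto
    ultimately show "f_alpha \<alpha> x < f_alpha \<alpha> y"
      using \<alpha> f_alpha_eq_half_angle_fun[OF xy(1)] f_alpha_eq_half_angle_fun[OF xy(2)]
      by (auto intro!: half_angle_fun_less)
  qed
next
  assume \<alpha>: "\<alpha> \<le> 4 * (pi - 2) / (sqrt 2 * (4 - pi))"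
  show "strict_antimono_on {0<..1} (f_alpha \<alpha>)"
  proof (rule monotone_onI)
    fix x y :: real assume xy: "x \<in> {0<..1}" "y \<in> {0<..1}" "x < y"
    then have "arcsin x / 2 < arcsin y / 2"
      by (simp add: arcsin_less_mono)
    moreover have "critical_alpha (pi / 4) \<le> critical_alpha (arcsin y / 2)"
    proof -
      \<comment> \<open>Equality with \<open>pi / 4\<close> must be included, since it occurs at
        \<open>y = 1\<close>.\<close>
      have "pi / 4 < pi" by simp
      then have "critical_alpha (pi / 4) \<le> critical_alpha s" if "0 < s" "s \<le> pi / 4" for s
        using that critical_alpha_less[of s "pi / 4"] by (metis less_eq_real_def)
      then show ?thesis
        using f_alpha_eq_half_angle_fun(2,3)[OF xy(2)] by blast
    qed
    ultimately show "f_alpha \<alpha> y < f_alpha \<alpha> x"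
      using \<alpha> f_alpha_eq_half_angle_fun[OF xy(1)] f_alpha_eq_half_angle_fun[OF xy(2)]
      by (auto intro!: half_angle_fun_greater simp: critical_alpha_pi_fourth)
  qed
next
  assume \<alpha>: "4 > \<alpha> \<and> \<alpha> > 4 * (pi - 2) / (sqrt 2 * (4 - pi))"
  then obtain c where c: "0 < c" "c \<le> pi / 4"
    "\<And>s. 0 < s \<Longrightarrow> s \<le> pi / 4 \<Longrightarrow> s \<noteq> c \<Longrightarrow> half_angle_fun \<alpha> c < half_angle_fun \<alpha> s"
    using half_angle_fun_unique_min[of \<alpha>] by (auto simp: critical_alpha_pi_fourth)
  define x where "x = sin (2 * c)"
  have x: "x \<in> {0<..1}"
    using c by (auto simp: x_def intro!: sin_gt_zero)
  \<comment> \<open>Strictness against every other point gives both minimality and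
    uniqueness.\<close>
  have less: "f_alpha \<alpha> x < f_alpha \<alpha> y" if y: "y \<in> {0<..1}" "y \<noteq> x" for y
  proof -
    have "arcsin y / 2 \<noteq> c"
    proof
      assume "arcsin y / 2 = c"
      then have "2 * c = arcsin y" by simp
      with y show False by (simp add: x_def)
    qed
    then show ?thesis
      using c f_alpha_eq_half_angle_fun[OF y(1)] f_alpha_sin_double[OF c(1,2)]
      by (auto simp: x_def)
  qed
  show "\<exists>!x\<in>{0<..1}. \<forall>y\<in>{0<..1}. f_alpha \<alpha> x \<le> f_alpha \<alpha> y"
  proof (rule ex1I[of _ x])
    show "x \<in> {0<..1} \<and> (\<forall>y\<in>{0<..1}. f_alpha \<alpha> x \<le> f_alpha \<alpha> y)"
      using x less by (metis less_imp_le order_refl)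
    show "z = x" if "z \<in> {0<..1} \<and> (\<forall>y\<in>{0<..1}. f_alpha \<alpha> z \<le> f_alpha \<alpha> y)" for z
      using that x less by (meson not_le)
  qed
qed

end
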